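(* There exists a constant $\delta > 0$ such that for all integers $t \geq 3$ and $n \geq 1$, $\rho(n, K_t) \geq \delta\, n^{3/t}$.
   Context: An orthonormal representation of a graph $G$ in $\mathbb{R}^d$ is a map $f: V(G) \to \mathbb{R}^d$ with $\|f(u)\|=1$ for all $u$ and $\langle f(u), f(v)\rangle = 0$ for all distinct non-adjacent $u,v$ (distinct vertices may receive the same vector). The minimum semidefinite rank $\mathrm{msr}(G)$ is the minimum $d$ such that $G$ has an orthonormal representation in $\mathbb{R}^d$. A graph is $H$-free if it contains no subgraph isomorphic to $H$. $\rho(n,H)$ is the minimum of $\mathrm{msr}(G)$ over all $H$-free simple graphs $G$ on $n$ vertices. $K_t$ is the complete graph on $t$ vertices. *)

theory Defs
  imports
    Complex_Main
    "Graph_Theory.Graph_Theory"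
    "Jordan_Normal_Form.Matrix"
begin

text \<open>
  Finite simple graphs are represented by \<open>pair_graph\<close>: each undirected edge is a pair of
  opposite arcs. The space \<open>\<real>\<^sup>d\<close> is \<open>carrier_vec d\<close>, so that \<open>d\<close> can be minimised over.
\<close>

definition euclidean_norm :: "real vec \<Rightarrow> real" where
  "euclidean_norm x = sqrt (scalar_prod x x)"

definition orthonormal_rep :: "'a pair_pre_digraph \<Rightarrow> nat \<Rightarrow> ('a \<Rightarrow> real vec) \<Rightarrow> bool" where
  "orthonormal_rep G d f \<longleftrightarrow>
     (\<forall>u \<in> pverts G. f u \<in> carrier_vec d \<and> euclidean_norm (f u) = 1) \<and>
     (\<forall>u \<in> pverts G. \<forall>v \<in> pverts G.
        u \<noteq> v \<and> (u, v) \<notin> parcs G \<longrightarrow> scalar_prod (f u) (f v) = 0)"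

definition msr :: "'a pair_pre_digraph \<Rightarrow> nat" where
  "msr G = (LEAST d. \<exists>f. orthonormal_rep G d f)"

definition graph_free :: "'b pair_pre_digraph \<Rightarrow> 'a pair_pre_digraph \<Rightarrow> bool" where
  "graph_free H G \<longleftrightarrow> \<not> (\<exists>S. subgraph S (with_proj G) \<and> digraph_iso (with_proj H) S)"

text \<open>
  Every graph on \<open>n\<close> vertices is isomorphic to one whose vertices are natural numbers, so the
  minimum below is over all \<open>H\<close>-free graphs on \<open>n\<close> vertices. (If there is no such graph, which
  can happen only for edgeless \<open>H\<close>, the value is unspecified.)
\<close>

definition rho :: "nat \<Rightarrow> 'b pair_pre_digraph \<Rightarrow> nat" where
  "rho n H = (LEAST r. \<exists>G :: nat pair_pre_digraph.
     pair_graph G \<and> card (pverts G) = n \<and> graph_free H G \<and> msr G = r)"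

definition complete_graph :: "nat \<Rightarrow> nat pair_pre_digraph" where
  "complete_graph t = \<lparr> pverts = {..<t}, parcs = {(u, v). u < t \<and> v < t \<and> u \<noteq> v} \<rparr>"

lemma complete_graph_complete_digraph: "complete_digraph t (with_proj (complete_graph t))"
  by (auto simp: complete_digraph_pair_def complete_graph_def)

lemma orthonormal_rep_exists:
  assumes "pair_graph G"
  shows "\<exists>f. orthonormal_rep G (card (pverts G)) f"
proof -
  interpret pair_graph G by fact
  let ?n = "card (pverts G)"
  obtain h where h: "bij_betw h (pverts G) {..<?n}"
    using ex_bij_betw_finite_nat[OF pair_finite_verts] by (auto simp: atLeast0LessThan)
  have lt: "h u < ?n" if "u \<in> pverts G" for u
    using h that by (auto dest: bij_betwE)
  have ne: "h u \<noteq> h v" if "u \<in> pverts G" "v \<in> pverts G" "u \<noteq> v" for u v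
    using h that by (auto simp: bij_betw_def inj_on_def)
  have "orthonormal_rep G ?n (\<lambda>u. unit_vec ?n (h u))"
    unfolding orthonormal_rep_def euclidean_norm_def
    using lt ne by (auto simp: index_unit_vec)
  then show ?thesis by blast
qed

lemma orthonormal_rep_msr:
  assumes "pair_graph G"
  shows "\<exists>f. orthonormal_rep G (msr G) f"
  unfolding msr_def using orthonormal_rep_exists[OF assms] by (rule LeastI)

lemma graph_free_complete_graph_iff:
  assumes "pair_graph G"
  shows "graph_free (complete_graph t) G \<longleftrightarrow>
    \<not> (\<exists>C \<subseteq> pverts G. card C = t \<and> finite C \<and> (\<forall>u \<in> C. \<forall>v \<in> C. u \<noteq> v \<longrightarrow> (u, v) \<in> parcs G))"
proof -
  interpret G: pair_graph G by fact
  have K: "pair_graph (complete_graph t)"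
    using complete_graph_complete_digraph by (rule pair_graphI_complete)
  interpret K: pair_graph "complete_graph t" by (rule K)
  have "(\<exists>S. subgraph S (with_proj G) \<and> digraph_iso (with_proj (complete_graph t)) S) \<longleftrightarrow>
    (\<exists>C \<subseteq> pverts G. card C = t \<and> finite C \<and> (\<forall>u \<in> C. \<forall>v \<in> C. u \<noteq> v \<longrightarrow> (u, v) \<in> parcs G))"
    (is "?L \<longleftrightarrow> ?R")
  proof
    assume ?L
    then obtain S f where S: "subgraph S (with_proj G)"
      and f: "pre_digraph.digraph_isomorphism (with_proj (complete_graph t)) f"
      and Sf: "S = app_iso f (with_proj (complete_graph t))"
      unfolding digraph_iso_def by blast
    have tl: "tail S = fst" "head S = snd"
      using S by (auto simp: subgraph_def compatible_def)
    have sub: "verts S \<subseteq> pverts G" "arcs S \<subseteq> parcs G"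
      using S by (auto simp: subgraph_def)
    have fs: "inj_on (iso_verts f) {..<t}"
      "\<And>a. a \<in> parcs (complete_graph t) \<Longrightarrow> iso_verts f (fst a) = iso_tail f (iso_arcs f a)
          \<and> iso_verts f (snd a) = iso_head f (iso_arcs f a)"
      using f unfolding pre_digraph.digraph_isomorphism_def
      by (auto simp: complete_graph_def)
    let ?C = "iso_verts f ` {..<t}"
    have vC: "verts S = ?C" by (simp add: Sf complete_graph_def)
    have "(iso_verts f i, iso_verts f j) \<in> parcs G" if "i < t" "j < t" "i \<noteq> j" for i j
    proof -
      have a: "(i, j) \<in> parcs (complete_graph t)" using that by (simp add: complete_graph_def)
      have "iso_arcs f (i, j) \<in> arcs S" using a by (simp add: Sf)
      moreover have "iso_arcs f (i, j) = (iso_verts f i, iso_verts f j)"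
        using fs(2)[OF a] tl by (simp add: Sf prod_eq_iff)
      ultimately show ?thesis using sub by auto
    qed
    then show ?R
      using vC sub fs(1) by (intro exI[of _ ?C]) (auto simp: card_image)
  next
    assume ?R
    then obtain C where C: "C \<subseteq> pverts G" "card C = t" "finite C"
      "\<And>u v. u \<in> C \<Longrightarrow> v \<in> C \<Longrightarrow> u \<noteq> v \<Longrightarrow> (u, v) \<in> parcs G" by blast
    obtain h where h: "bij_betw h {..<t} C"
      using ex_bij_betw_nat_finite[OF C(3)] C(2) by (auto simp: atLeast0LessThan)
    have inj: "inj_on h {..<t}" and hC: "\<And>i. i < t \<Longrightarrow> h i \<in> C"
      using h by (auto simp: bij_betw_def)
    have hne: "\<And>i j. i < t \<Longrightarrow> j < t \<Longrightarrow> i \<noteq> j \<Longrightarrow> h i \<noteq> h j"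
      using inj by (auto simp: inj_on_def)
    define f where "f = \<lparr> iso_verts = h, iso_arcs = map_prod h h,
      iso_head = (snd :: 'a \<times> 'a \<Rightarrow> 'a), iso_tail = fst \<rparr>"
    have iso: "pre_digraph.digraph_isomorphism (with_proj (complete_graph t)) f"
      unfolding pre_digraph.digraph_isomorphism_def f_def using inj K.wf_digraph
      by (auto simp: complete_graph_def inj_on_def)
    have "wf_digraph (app_iso f (with_proj (complete_graph t)))"
      using iso by (rule K.wf_digraphI_app_iso)
    then have "subgraph (app_iso f (with_proj (complete_graph t))) (with_proj G)"
      using C hC hne G.wf_digraph unfolding subgraph_def
      by (auto simp: compatible_def f_def complete_graph_def)
    then show ?L using iso unfolding digraph_iso_def by blast
  qed
  then show ?thesis by (simp add: graph_free_def)
qed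

lemma rho_attained:
  assumes "t \<ge> 2"
  shows "\<exists>G :: nat pair_pre_digraph. pair_graph G \<and> card (pverts G) = n \<and>
    graph_free (complete_graph t) G \<and> msr G = rho n (complete_graph t)"
proof -
  let ?G = "\<lparr> pverts = {..<n}, parcs = {} \<rparr> :: nat pair_pre_digraph"
  have G: "pair_graph ?G"
    by unfold_locales (auto simp: symmetric_def sym_def)
  have "graph_free (complete_graph t) ?G"
    unfolding graph_free_complete_graph_iff[OF G]
  proof (rule notI, elim exE conjE)
    fix C assume "card C = t" "finite C"
      "\<forall>u\<in>C. \<forall>v\<in>C. u \<noteq> v \<longrightarrow> (u, v) \<in> parcs ?G"
    then show False using assms card_le_Suc0_iff_eq[of C] by auto
  qed
  then have "\<exists>r. \<exists>G :: nat pair_pre_digraph. pair_graph G \<and> card (pverts G) = n \<and>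
    graph_free (complete_graph t) G \<and> msr G = r"
    using G by (intro exI[of _ "msr ?G"] exI[of _ ?G]) simp
  then show ?thesis unfolding rho_def by (rule LeastI_ex)
qed

end

theory Submission
  imports Defs "HOL-Analysis.Convex"
begin

text \<open>
  The trace inequality \<open>(tr A)\<^sup>2 \<le> rank A * tr (A\<^sup>2)\<close> for the Gram matrix \<open>A\<close> of \<open>n\<close> unit vectors
  in \<open>\<real>\<^sup>d\<close> yields \<open>n \<le> d (1 + M)\<close>, where \<open>M\<close> bounds the sum of squared inner products of a vector
  with its neighbours. The neighbourhood \<open>N\<close> of a vertex of a \<open>K\<^sub>s\<^sub>+\<^sub>1\<close>-free graph is \<open>K\<^sub>s\<close>-free,
  and for \<open>s \<ge> 3\<close> this forces \<open>M \<le> 27 |N|\<close> to the power \<open>1 - 2/s\<close>; inserting the inductive bound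
  \<open>|N| \<le> (28 d)\<close> to the power \<open>s/3\<close> closes an induction on \<open>s\<close>.

  The bound on \<open>M\<close> comes from a weak-type estimate: for a \<open>K\<^sub>s\<close>-free family at most
  \<open>(3/\<epsilon>)\<close> to the power \<open>s\<close> members have inner product at least \<open>\<epsilon>\<close> in absolute value with a given
  unit vector. It is proved by induction on \<open>s\<close>: the signed sum of the \<open>N\<close> members with large inner
  product has norm at least \<open>N \<epsilon>\<close>, so some row of their Gram matrix has absolute sum at least
  \<open>N \<epsilon>\<^sup>2\<close>, whereas the estimate for \<open>s - 1\<close> bounds both the number of nonzero entries of this row
  and their sum.
\<close>

section \<open>Inner products of coordinate functions\<close>

text \<open>Only the coordinates below \<open>d\<close> are read, so linear combinations are plain
  lambda terms without carrier conditions.\<close>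

definition dot :: "nat \<Rightarrow> (nat \<Rightarrow> real) \<Rightarrow> (nat \<Rightarrow> real) \<Rightarrow> real" where
  "dot d x y = (\<Sum>i<d. x i * y i)"

lemma dot_commute: "dot d x y = dot d y x"
  by (simp add: dot_def mult.commute)

lemma dot_sum_left: "dot d (\<lambda>i. \<Sum>v\<in>A. c v * g v i) y = (\<Sum>v\<in>A. c v * dot d (g v) y)"
  unfolding dot_def sum_distrib_left sum_distrib_right
  by (subst sum.swap) (simp add: mult.assoc)

lemma dot_sum_right: "dot d y (\<lambda>i. \<Sum>v\<in>A. c v * g v i) = (\<Sum>v\<in>A. c v * dot d y (g v))"
  using dot_sum_left[where y = y] by (simp add: dot_commute)

lemma dot_Cauchy_Schwarz: "(dot d x y)\<^sup>2 \<le> dot d x x * dot d y y"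
  using Cauchy_Schwarz_ineq_sum[of x y "{..<d}"] by (simp add: dot_def power2_eq_square)

section \<open>Power sums and sums of decaying values\<close>

text \<open>Concavity of \<open>x powr a\<close>: the tangent at \<open>Suc n\<close> lies above the
  graph at \<open>n\<close>.\<close>

lemma powr_increment:
  fixes a :: real
  assumes "0 < a" "a \<le> 1"
  shows "real n powr a + a * real (Suc n) powr (a - 1) \<le> real (Suc n) powr a"
proof (cases "n = 0")
  case True
  then show ?thesis using assms by simp
next
  case False
  have "real n powr a * real (Suc n) powr (1 - a) \<le> a * real n + (1 - a) * real (Suc n)"
    using assms False by (intro Youngs_inequality_0) auto
  then have "real n powr a * real (Suc n) powr (1 - a) * real (Suc n) powr (a - 1)
      \<le> (real (Suc n) - a) * real (Suc n) powr (a - 1)"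
    by (intro mult_right_mono) (auto simp: algebra_simps)
  moreover have "real (Suc n) powr (1 - a) * real (Suc n) powr (a - 1) = 1"
    by (subst powr_add[symmetric]) simp
  moreover have "real (Suc n) * real (Suc n) powr (a - 1) = real (Suc n) powr a"
    using powr_mult_base[of "real (Suc n)" "a - 1"] by simp
  ultimately show ?thesis by (simp add: mult.assoc left_diff_distrib)
qed

text \<open>
  A discrete layer-cake estimate: the hypothesis says that the \<open>k\<close>-th largest value of \<open>g\<close> is at most
  \<open>K\<close> times \<open>k\<close> to the power \<open>- b\<close>.
\<close>

lemma sum_le_of_weak_type:
  fixes g :: "'a \<Rightarrow> real"
  assumes "finite A" "0 \<le> b" "b < 1"
    and "\<And>B. B \<subseteq> A \<Longrightarrow> B \<noteq> {} \<Longrightarrow> \<exists>v\<in>B. g v \<le> K * real (card B) powr (- b)" and "0 \<le> K"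
  shows "sum g A \<le> K / (1 - b) * real (card A) powr (1 - b)"
  using assms(1,4)
proof (induction "card A" arbitrary: A)
  case 0
  then show ?case by simp
next
  case (Suc n)
  then have "A \<noteq> {}" by auto
  then obtain v where v: "v \<in> A" "g v \<le> K * real (card A) powr (- b)"
    using Suc.prems(2)[of A] by blast
  have n: "n = card (A - {v})" using Suc.hyps(2) v Suc.prems(1) by simp
  have "sum g (A - {v}) \<le> K / (1 - b) * real (card (A - {v})) powr (1 - b)"
    using Suc.prems by (intro Suc.hyps(1) n) (simp, meson Diff_subset subset_trans)
  then have "sum g A \<le> K * real (Suc n) powr (- b) + K / (1 - b) * real n powr (1 - b)"
    using v Suc.prems(1) Suc.hyps(2) n by (simp add: sum.remove)
  \<comment> \<open>The exponent \<open>- b\<close> becomes \<open>(1 - b) - 1\<close>, so that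
    \<open>powr_increment\<close> applies with \<open>a = 1 - b\<close>.\<close>
  also have "\<dots> = K / (1 - b) * (real n powr (1 - b) + (1 - b) * real (Suc n) powr ((1 - b) - 1))"
    using assms(3) by (simp add: field_simps)
  also have "\<dots> \<le> K / (1 - b) * real (Suc n) powr (1 - b)"
    using assms by (intro mult_left_mono powr_increment) auto
  finally show ?case using Suc.hyps(2) by simp
qed

section \<open>Families of unit vectors and their cliques\<close>

locale unit_vectors =
  fixes d :: nat and f :: "'a \<Rightarrow> nat \<Rightarrow> real" and V :: "'a set"
  assumes finite_V: "finite V"
    and unit: "u \<in> V \<Longrightarrow> dot d (f u) (f u) = 1"
begin

text \<open>
  Two indices count as adjacent when their vectors are not orthogonal. In an orthonormal
  representation this gives a subgraph of the represented graph, so no cliques are added.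
\<close>

definition clique_free :: "nat \<Rightarrow> 'a set \<Rightarrow> bool" where
  "clique_free s U \<longleftrightarrow>
     \<not> (\<exists>C\<subseteq>U. card C = s \<and> (\<forall>u\<in>C. \<forall>v\<in>C. u \<noteq> v \<longrightarrow> dot d (f u) (f v) \<noteq> 0))"

definition nbhd :: "'a set \<Rightarrow> 'a \<Rightarrow> 'a set" where
  "nbhd U u = {v \<in> U. v \<noteq> u \<and> dot d (f u) (f v) \<noteq> 0}"

lemma nbhd_subset: "nbhd U u \<subseteq> U"
  by (auto simp: nbhd_def)

lemma clique_free_mono: "clique_free s U \<Longrightarrow> W \<subseteq> U \<Longrightarrow> clique_free s W"
  unfolding clique_free_def by (blast intro: subset_trans)

lemma clique_free_nbhd:
  assumes "clique_free (Suc s) U" "U \<subseteq> V" "u \<in> U"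
  shows "clique_free s (nbhd U u)"
  unfolding clique_free_def
proof (intro notI, elim exE conjE)
  fix C assume C: "C \<subseteq> nbhd U u" "card C = s"
    "\<forall>u\<in>C. \<forall>v\<in>C. u \<noteq> v \<longrightarrow> dot d (f u) (f v) \<noteq> 0"
  have adj: "dot d (f u) (f x) \<noteq> 0 \<and> dot d (f x) (f u) \<noteq> 0" if "x \<in> C" for x
    using C(1) that dot_commute[of d "f x" "f u"] by (auto simp: nbhd_def)
  have "finite C" using C(1) nbhd_subset assms(2) finite_V by (meson finite_subset)
  moreover have "u \<notin> C" using C(1) by (auto simp: nbhd_def)
  ultimately have "card (insert u C) = Suc s" using C(2) by simp
  moreover have "insert u C \<subseteq> U" using C(1) assms(3) nbhd_subset by blast
  moreover have "\<forall>x\<in>insert u C. \<forall>y\<in>insert u C. x \<noteq> y \<longrightarrow> dot d (f x) (f y) \<noteq> 0"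
    using C(3) adj by auto
  ultimately show False using assms(1) unfolding clique_free_def by blast
qed

text \<open>Vectors orthogonal to \<open>f u\<close> contribute \<open>h 0 = 0\<close>, and
  \<open>u\<close> itself contributes \<open>h 1\<close>. It serves for \<open>abs\<close> and for
  squares.\<close>

lemma sum_nbhd:
  assumes "U \<subseteq> V" "u \<in> U" "h 0 = 0"
  shows "(\<Sum>v\<in>U. h (dot d (f u) (f v))) = h 1 + (\<Sum>v\<in>nbhd U u. h (dot d (f u) (f v)))"
proof -
  have fin: "finite U" using assms(1) finite_V by (rule finite_subset)
  have "(\<Sum>v\<in>U. h (dot d (f u) (f v))) = h 1 + (\<Sum>v\<in>U - {u}. h (dot d (f u) (f v)))"
    using fin assms unit by (subst sum.remove[of _ u]) auto
  also have "(\<Sum>v\<in>U - {u}. h (dot d (f u) (f v))) = (\<Sum>v\<in>nbhd U u. h (dot d (f u) (f v)))"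
    using fin assms(3) by (intro sum.mono_neutral_right) (auto simp: nbhd_def)
  finally show ?thesis .
qed

text \<open>Cauchy-Schwarz for \<open>y\<close> and the signed sum \<open>S\<close>: the signs turn
  the inner product with \<open>y\<close> into the sum of absolute values, and being at most 1 in
  size they drop out of \<open>dot d S S\<close>.\<close>

lemma sum_abs_dot_sq_le:
  assumes "dot d y y = 1"
  shows "(\<Sum>v\<in>U. \<bar>dot d y (f v)\<bar>)\<^sup>2 \<le> (\<Sum>u\<in>U. \<Sum>v\<in>U. \<bar>dot d (f u) (f v)\<bar>)"
proof -
  define c where "c v = sgn (dot d y (f v))" for v
  define S where "S = (\<lambda>i. \<Sum>v\<in>U. c v * f v i)"
  have "dot d S y = (\<Sum>v\<in>U. \<bar>dot d y (f v)\<bar>)"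
    unfolding S_def dot_sum_left
    by (intro sum.cong) (simp_all add: c_def dot_commute abs_sgn mult.commute)
  then have "(\<Sum>v\<in>U. \<bar>dot d y (f v)\<bar>)\<^sup>2 \<le> dot d S S"
    using dot_Cauchy_Schwarz[of d S y] assms by simp
  also have "dot d S S = (\<Sum>u\<in>U. c u * (\<Sum>v\<in>U. c v * dot d (f u) (f v)))"
    unfolding S_def dot_sum_left dot_sum_right ..
  also have "\<dots> \<le> (\<Sum>u\<in>U. \<Sum>v\<in>U. \<bar>dot d (f u) (f v)\<bar>)"
    unfolding sum_distrib_left
  proof (intro sum_mono)
    fix u v
    have "c u * (c v * dot d (f u) (f v)) \<le> \<bar>c u\<bar> * \<bar>c v\<bar> * \<bar>dot d (f u) (f v)\<bar>"
      by (metis abs_ge_self abs_mult mult.assoc)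
    also have "\<dots> \<le> 1 * 1 * \<bar>dot d (f u) (f v)\<bar>"
      by (intro mult_mono) (auto simp: c_def abs_sgn_eq)
    finally show "c u * (c v * dot d (f u) (f v)) \<le> \<bar>dot d (f u) (f v)\<bar>" by simp
  qed
  finally show ?thesis .
qed

text \<open>Without a nonorthogonal pair the family is orthonormal. The projection \<open>S\<close>
  of \<open>y\<close> satisfies \<open>dot d S y = dot d S S = q\<close>, so Cauchy-Schwarz gives
  \<open>q * q \<le> q\<close>.\<close>

lemma Bessel:
  assumes "clique_free 2 U" "U \<subseteq> V" "dot d y y = 1"
  shows "(\<Sum>v\<in>U. (dot d y (f v))\<^sup>2) \<le> 1"
proof -
  have fin: "finite U" using assms(2) finite_V by (rule finite_subset)
  define c where "c v = dot d y (f v)" for v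
  define S where "S = (\<lambda>i. \<Sum>v\<in>U. c v * f v i)"
  define q where "q = (\<Sum>v\<in>U. (c v)\<^sup>2)"
  have orth: "dot d (f u) (f v) = (if u = v then 1 else 0)" if "u \<in> U" "v \<in> U" for u v
  proof (cases "u = v")
    case False
    have "dot d (f u) (f v) = 0"
    proof (rule ccontr)
      assume "dot d (f u) (f v) \<noteq> 0"
      then have "\<forall>x\<in>{u, v}. \<forall>y\<in>{u, v}. x \<noteq> y \<longrightarrow> dot d (f x) (f y) \<noteq> 0"
        by (auto simp: dot_commute)
      moreover have "card {u, v} = 2" "{u, v} \<subseteq> U" using False that by auto
      ultimately show False using assms(1) unfolding clique_free_def by blast
    qed
    then show ?thesis using False by simp
  qed (use that assms(2) unit in auto)
  have "dot d S y = q"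
    unfolding S_def dot_sum_left q_def
    by (intro sum.cong) (simp_all add: c_def dot_commute power2_eq_square)
  moreover have "dot d S S = q"
  proof -
    have "dot d S S = (\<Sum>u\<in>U. c u * (\<Sum>v\<in>U. c v * dot d (f u) (f v)))"
      unfolding S_def dot_sum_left dot_sum_right ..
    also have "\<dots> = (\<Sum>u\<in>U. c u * (\<Sum>v\<in>U. if u = v then c v else 0))"
      by (intro sum.cong refl arg_cong2[where f = "(*)"]) (auto simp: orth)
    also have "\<dots> = q" using fin by (simp add: q_def power2_eq_square)
    finally show ?thesis .
  qed
  ultimately have "q * q \<le> q" 
    using dot_Cauchy_Schwarz[of d S y] assms(3) by (simp add: power2_eq_square)
  then have "q \<le> 1" using mult_le_cancel_left_pos[of q q 1] by (cases "0 < q") auto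
  then show ?thesis by (simp add: q_def c_def)
qed

section \<open>The weak-type estimate\<close>

definition weak_bound :: "nat \<Rightarrow> bool" where
  "weak_bound s \<longleftrightarrow> (\<forall>U y \<epsilon>. U \<subseteq> V \<longrightarrow> clique_free s U \<longrightarrow> dot d y y = 1 \<longrightarrow> 0 < \<epsilon> \<longrightarrow>
     (\<forall>v\<in>U. \<epsilon> \<le> \<bar>dot d y (f v)\<bar>) \<longrightarrow> real (card U) \<le> (3 / \<epsilon>) ^ s)"

text \<open>Taking for \<open>\<epsilon>\<close> the least absolute inner product turns the count
  into a decay rate, the form that \<open>sum_le_of_weak_type\<close> asks of every nonempty
  subset.\<close>

lemma ex_small_dot:
  assumes "weak_bound s" "0 < s" "U \<subseteq> V" "U \<noteq> {}" "clique_free s U" "dot d y y = 1"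
  shows "\<exists>v\<in>U. \<bar>dot d y (f v)\<bar> \<le> 3 * real (card U) powr (- 1 / real s)"
proof (rule ccontr)
  assume "\<not> ?thesis"
  then have large: "\<bar>dot d y (f v)\<bar> > 3 * real (card U) powr (- 1 / real s)" if "v \<in> U" for v
    using that by force
  have fin: "finite U" using assms(3) finite_V by (rule finite_subset)
  define \<epsilon> where "\<epsilon> = Min ((\<lambda>v. \<bar>dot d y (f v)\<bar>) ` U)"
  have "\<epsilon> \<in> (\<lambda>v. \<bar>dot d y (f v)\<bar>) ` U" 
    unfolding \<epsilon>_def using fin assms(4) by (intro Min_in) auto
  then have \<epsilon>: "3 * real (card U) powr (- 1 / real s) < \<epsilon>" using large by auto
  have N: "0 < real (card U)" using fin assms(4) by (simp add: card_gt_0_iff)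
  have \<epsilon>0: "0 < \<epsilon>" using \<epsilon> by (smt (verit) N powr_gt_zero)
  have "\<forall>v\<in>U. \<epsilon> \<le> \<bar>dot d y (f v)\<bar>" using fin by (auto simp: \<epsilon>_def)
  then have "real (card U) \<le> (3 / \<epsilon>) ^ s"
    using assms \<epsilon>0 unfolding weak_bound_def by blast
  also have "\<dots> < (real (card U) powr (1 / real s)) ^ s"
  proof (intro power_strict_mono)
    have "3 < \<epsilon> * real (card U) powr (1 / real s)"
      using \<epsilon> N by (simp add: powr_minus field_simps)
    then show "3 / \<epsilon> < real (card U) powr (1 / real s)"
      using \<epsilon>0 by (simp add: field_simps)
  qed (use \<epsilon>0 assms(2) in auto)
  also have "\<dots> = real (card U)"
    using N assms(2) by (simp add: powr_realpow[symmetric] powr_powr)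
  finally show False by simp
qed

lemma sum_abs_dot_le:
  assumes "weak_bound s" "2 \<le> s" "U \<subseteq> V" "clique_free s U" "dot d y y = 1"
  shows "(\<Sum>v\<in>U. \<bar>dot d y (f v)\<bar>) \<le> 6 * real (card U) powr (1 - 1 / real s)"
proof -
  have fin: "finite U" using assms(3) finite_V by (rule finite_subset)
  have "(\<Sum>v\<in>U. \<bar>dot d y (f v)\<bar>) \<le> 3 / (1 - 1 / real s) * real (card U) powr (1 - 1 / real s)"
  proof (rule sum_le_of_weak_type[OF fin])
    fix B assume "B \<subseteq> U" "B \<noteq> {}"
    then show "\<exists>v\<in>B. \<bar>dot d y (f v)\<bar> \<le> 3 * real (card B) powr - (1 / real s)"
      using ex_small_dot[of s B y] assms clique_free_mono[of s U B] by auto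
  qed (use assms(2) in auto)
  also have "3 / (1 - 1 / real s) \<le> 6" using assms(2) by (simp add: field_simps)
  finally show ?thesis by (simp add: mult_right_mono)
qed

text \<open>Squaring doubles the decay exponent to \<open>2 / s\<close>, which is below 1 once
  \<open>s \<ge> 3\<close>; the factor \<open>9 / (1 - 2 / s)\<close> is then largest at
  \<open>s = 3\<close>, with value 27.\<close>

lemma sum_dot_sq_le:
  assumes "weak_bound s" "3 \<le> s" "U \<subseteq> V" "clique_free s U" "dot d y y = 1"
  shows "(\<Sum>v\<in>U. (dot d y (f v))\<^sup>2) \<le> 27 * real (card U) powr (1 - 2 / real s)"
proof -
  have fin: "finite U" using assms(3) finite_V by (rule finite_subset)
  have "(\<Sum>v\<in>U. (dot d y (f v))\<^sup>2) \<le> 9 / (1 - 2 / real s) * real (card U) powr (1 - 2 / real s)"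
  proof (rule sum_le_of_weak_type[OF fin])
    fix B assume B: "B \<subseteq> U" "B \<noteq> {}"
    then obtain v where v: "v \<in> B" "\<bar>dot d y (f v)\<bar> \<le> 3 * real (card B) powr (- 1 / real s)"
      using ex_small_dot[of s B y] assms clique_free_mono[of s U B] by auto
    have "(dot d y (f v))\<^sup>2 \<le> (3 * real (card B) powr (- 1 / real s))\<^sup>2"
      using power_mono[OF v(2), of 2] by simp
    also have "\<dots> = 9 * real (card B) powr - (2 / real s)"
      by (simp add: power_mult_distrib power2_eq_square powr_add[symmetric])
    finally show "\<exists>v\<in>B. (dot d y (f v))\<^sup>2 \<le> 9 * real (card B) powr - (2 / real s)"
      using v(1) by blast
  qed (use assms(2) in auto)
  also have "9 / (1 - 2 / real s) \<le> 27" using assms(2) by (simp add: field_simps)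
  finally show ?thesis by (simp add: mult_right_mono)
qed

lemma weak_bound_2: "weak_bound 2"
  unfolding weak_bound_def
proof (intro allI impI)
  fix U y and \<epsilon> :: real
  assume U: "U \<subseteq> V" "clique_free 2 U" "dot d y y = 1" "0 < \<epsilon>" "\<forall>v\<in>U. \<epsilon> \<le> \<bar>dot d y (f v)\<bar>"
  have "real (card U) * \<epsilon>\<^sup>2 = (\<Sum>v\<in>U. \<epsilon>\<^sup>2)" by simp
  also have "\<dots> \<le> (\<Sum>v\<in>U. (dot d y (f v))\<^sup>2)"
    using U(4,5) by (intro sum_mono) (auto simp: abs_le_square_iff[symmetric])
  also have "\<dots> \<le> 1" using Bessel U by blast
  finally show "real (card U) \<le> (3 / \<epsilon>)\<^sup>2" using U(4) by (simp add: field_simps)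
qed

lemma weak_bound_Suc:
  assumes "weak_bound s" "2 \<le> s"
  shows "weak_bound (Suc s)"
  unfolding weak_bound_def
proof (intro allI impI)
  fix U y and \<epsilon> :: real
  assume U: "U \<subseteq> V" "clique_free (Suc s) U" "dot d y y = 1" "0 < \<epsilon>"
    and large: "\<forall>v\<in>U. \<epsilon> \<le> \<bar>dot d y (f v)\<bar>"
  show "real (card U) \<le> (3 / \<epsilon>) ^ Suc s"
  proof (cases "U = {}")
    case True
    then show ?thesis using U(4) by simp
  next
    case False
    have fin: "finite U" using U(1) finite_V by (rule finite_subset)
    define N where "N = real (card U)"
    have N: "0 < N" using fin False by (simp add: N_def card_gt_0_iff)
    have row: "(\<Sum>v\<in>U. \<bar>dot d (f u) (f v)\<bar>) \<le> 1 + 6 * (3 / \<epsilon>) ^ (s - 1)" if u: "u \<in> U" for u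
    proof -
      have sub: "nbhd U u \<subseteq> U" and free: "clique_free s (nbhd U u)"
        using nbhd_subset clique_free_nbhd U u by auto
      \<comment> \<open>The neighbours still have large inner product with \<open>y\<close>, so the
        count uses \<open>y\<close>; for the row sum below, \<open>f u\<close> takes its
        place.\<close>
      have card: "real (card (nbhd U u)) \<le> (3 / \<epsilon>) ^ s"
        using assms(1) free sub U(1,3,4) large unfolding weak_bound_def by (meson subset_eq)
      have "(\<Sum>v\<in>nbhd U u. \<bar>dot d (f u) (f v)\<bar>)
          \<le> 6 * real (card (nbhd U u)) powr (1 - 1 / real s)"
        using assms free sub U(1) u unit by (intro sum_abs_dot_le) auto
      also have "\<dots> \<le> 6 * ((3 / \<epsilon>) ^ s) powr (1 - 1 / real s)"
        using card assms(2) by (intro mult_left_mono powr_mono2) auto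
      also have "((3 / \<epsilon>) ^ s) powr (1 - 1 / real s) = (3 / \<epsilon>) powr (real s * (1 - 1 / real s))"
        using U(4) by (simp add: powr_realpow[symmetric] powr_powr)
      also have "real s * (1 - 1 / real s) = real (s - 1)"
        using assms(2) by (simp add: field_simps of_nat_diff)
      also have "(3 / \<epsilon>) powr real (s - 1) = (3 / \<epsilon>) ^ (s - 1)"
        using U(4) by (simp add: powr_realpow)
      finally show ?thesis using sum_nbhd[OF U(1) u, of abs] by simp
    qed
    obtain v where v: "v \<in> U" using False by blast
    have "\<epsilon>\<^sup>2 \<le> (dot d y (f v))\<^sup>2"
      using large v U(4) by (auto simp: abs_le_square_iff[symmetric])
    also have "\<dots> \<le> 1" using dot_Cauchy_Schwarz[of d y "f v"] U v unit by auto
    finally have \<epsilon>1: "\<epsilon> \<le> 1" by (simp add: abs_square_le_1)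
    have "N * \<epsilon> = (\<Sum>v\<in>U. \<epsilon>)" by (simp add: N_def)
    also have "\<dots> \<le> (\<Sum>v\<in>U. \<bar>dot d y (f v)\<bar>)" using large by (intro sum_mono) auto
    finally have "(N * \<epsilon>)\<^sup>2 \<le> (\<Sum>v\<in>U. \<bar>dot d y (f v)\<bar>)\<^sup>2"
      using N U(4) by (intro power_mono) auto
    also have "\<dots> \<le> (\<Sum>u\<in>U. \<Sum>v\<in>U. \<bar>dot d (f u) (f v)\<bar>)" using sum_abs_dot_sq_le U(3) .
    also have "\<dots> \<le> (\<Sum>u\<in>U. 1 + 6 * (3 / \<epsilon>) ^ (s - 1))" using row by (rule sum_mono)
    also have "\<dots> = N * (1 + 6 * (3 / \<epsilon>) ^ (s - 1))" by (simp add: N_def)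
    finally have "N * \<epsilon>\<^sup>2 \<le> 1 + 6 * (3 / \<epsilon>) ^ (s - 1)"
      using N by (simp add: power2_eq_square mult.assoc mult.left_commute)
    \<comment> \<open>The constant 3 reproduces itself: \<open>1 + 6 * x \<le> 9 * x\<close> for
      \<open>x \<ge> 1\<close>, and 9 together with \<open>\<epsilon>\<^sup>2\<close> supplies the
      two factors \<open>3 / \<epsilon>\<close> that lead from \<open>s - 1\<close> to
      \<open>Suc s\<close>.\<close>
    also have "\<dots> \<le> 9 * (3 / \<epsilon>) ^ (s - 1)"
    proof -
      have "1 \<le> (3 / \<epsilon>) ^ (s - 1)" using \<epsilon>1 U(4) by (intro one_le_power) simp
      then show ?thesis by linarith
    qed
    finally have "N \<le> (3 / \<epsilon>)\<^sup>2 * (3 / \<epsilon>) ^ (s - 1)"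
      using U(4) by (simp add: field_simps)
    also have "\<dots> = (3 / \<epsilon>) ^ Suc s" using assms(2)
      by (subst power_add[symmetric]) simp
    finally show ?thesis by (simp add: N_def)
  qed
qed

lemma weak_bound: "2 \<le> s \<Longrightarrow> weak_bound s"
  by (induction s rule: dec_induct) (auto intro: weak_bound_2 weak_bound_Suc)

section \<open>The trace inequality and the induction on the clique size\<close>

text \<open>The trace of \<open>T\<close> is \<open>card U\<close>. Cauchy-Schwarz over its
  \<open>d\<close> diagonal entries gives the factor \<open>d\<close>; with the off-diagonal squares
  added, swapping sums yields the squared Gram entries.\<close>

lemma card_sq_le_sum_dot_sq:
  assumes "U \<subseteq> V"
  shows "(real (card U))\<^sup>2 \<le> real d * (\<Sum>u\<in>U. \<Sum>v\<in>U. (dot d (f u) (f v))\<^sup>2)"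
proof -
  \<comment> \<open>\<open>T\<close> is the \<open>d\<close>-by-\<open>d\<close> matrix with the same nonzero spectrum as the Gram matrix.\<close>
  define T where "T i j = (\<Sum>u\<in>U. f u i * f u j)" for i j
  have "real (card U) = (\<Sum>u\<in>U. dot d (f u) (f u))" using assms unit by (simp add: subset_eq)
  also have "\<dots> = (\<Sum>i<d. T i i)" unfolding dot_def T_def by (rule sum.swap)
  finally have "(real (card U))\<^sup>2 \<le> (\<Sum>i<d. (T i i)\<^sup>2) * real d"
    using sum_squared_le_sum_of_squares[of "\<lambda>i. T i i" "{..<d}"] by simp
  also have "(\<Sum>i<d. (T i i)\<^sup>2) \<le> (\<Sum>i<d. \<Sum>j<d. (T i j)\<^sup>2)"
    by (intro sum_mono member_le_sum[of _ _ "\<lambda>j. (T _ j)\<^sup>2"]) auto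
  also have "\<dots> = (\<Sum>i<d. \<Sum>j<d. \<Sum>u\<in>U. \<Sum>v\<in>U. (f u i * f v i) * (f u j * f v j))"
    by (simp add: T_def power2_eq_square sum_product mult_ac)
  also have "\<dots> = (\<Sum>u\<in>U. \<Sum>v\<in>U. \<Sum>i<d. \<Sum>j<d. (f u i * f v i) * (f u j * f v j))"
    by (simp add: sum.swap[of _ U "{..<d}"])
  also have "\<dots> = (\<Sum>u\<in>U. \<Sum>v\<in>U. (dot d (f u) (f v))\<^sup>2)"
    by (simp add: dot_def power2_eq_square sum_product)
  finally show ?thesis by (simp add: mult.commute mult_right_mono)
qed

lemma card_le_of_row_bound:
  assumes "U \<subseteq> V" "0 \<le> M" "\<And>u. u \<in> U \<Longrightarrow> (\<Sum>v\<in>nbhd U u. (dot d (f u) (f v))\<^sup>2) \<le> M"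
  shows "real (card U) \<le> real d * (1 + M)"
proof (cases "card U = 0")
  case False
  have "(\<Sum>u\<in>U. \<Sum>v\<in>U. (dot d (f u) (f v))\<^sup>2) \<le> (\<Sum>u\<in>U. 1 + M)"
  proof (rule sum_mono)
    fix u assume u: "u \<in> U"
    show "(\<Sum>v\<in>U. (dot d (f u) (f v))\<^sup>2) \<le> 1 + M"
      using sum_nbhd[OF assms(1) u, of power2] assms(3)[OF u] by simp
  qed
  then have "real d * (\<Sum>u\<in>U. \<Sum>v\<in>U. (dot d (f u) (f v))\<^sup>2) \<le> real d * (real (card U) * (1 + M))"
    by (intro mult_left_mono) auto
  with card_sq_le_sum_dot_sq[OF assms(1)]
  have "real (card U) * real (card U) \<le> real (card U) * (real d * (1 + M))"
    by (simp add: power2_eq_square mult.left_commute)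
  then show ?thesis using False by simp
qed (use assms(2) in simp)

lemma card_le_of_clique_free:
  assumes "3 \<le> t" "U \<subseteq> V" "clique_free t U"
  shows "real (card U) \<le> (28 * real d) powr (real t / 3)"
  using assms
proof (induction t arbitrary: U rule: dec_induct)
  case base
  \<comment> \<open>Neighbourhoods are orthonormal here, so Bessel gives
    \<open>M = 1\<close>.\<close>
  have "real (card U) \<le> real d * (1 + 1)"
  proof (rule card_le_of_row_bound[OF base(1)])
    fix u assume u: "u \<in> U"
    then have "clique_free 2 (nbhd U u)"
      using clique_free_nbhd[of 2 U u] base by (simp add: eval_nat_numeral)
    then show "(\<Sum>v\<in>nbhd U u. (dot d (f u) (f v))\<^sup>2) \<le> 1"
      using Bessel nbhd_subset base(1) u unit by (meson subset_eq)
  qed simp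
  then show ?case by simp
next
  case (step t)
  define D where "D = 28 * real d"
  show ?case
  proof (cases "U = {}")
    case False
    \<comment> \<open>Positive dimension gives \<open>D \<ge> 1\<close>, so powers of
      \<open>D\<close> with nonnegative exponent are at least 1.\<close>
    have "d \<noteq> 0"
    proof
      assume "d = 0"
      then have "dot d x x = 0" for x by (simp add: dot_def)
      then show False using unit False step.prems(1) by (metis ex_in_conv subset_eq zero_neq_one)
    qed
    then have D: "1 \<le> D" by (simp add: D_def)
    have "real (card U) \<le> real d * (1 + 27 * D powr ((real t - 2) / 3))"
    proof (rule card_le_of_row_bound[OF step.prems(1)])
      fix u assume u: "u \<in> U"
      have sub: "nbhd U u \<subseteq> V" and free: "clique_free t (nbhd U u)"
        using nbhd_subset[of U u] clique_free_nbhd step.prems u by auto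
      have "(\<Sum>v\<in>nbhd U u. (dot d (f u) (f v))\<^sup>2)
          \<le> 27 * real (card (nbhd U u)) powr (1 - 2 / real t)"
        using step.hyps step.prems sub free u unit by (intro sum_dot_sq_le weak_bound) auto
      also have "\<dots> \<le> 27 * (D powr (real t / 3)) powr (1 - 2 / real t)"
        using step.IH[OF sub free] step.hyps
        by (intro mult_left_mono powr_mono2) (auto simp: D_def)
      also have "(D powr (real t / 3)) powr (1 - 2 / real t) = D powr ((real t - 2) / 3)"
        using step.hyps(1) by (simp add: powr_powr right_diff_distrib diff_divide_distrib)
      finally show "(\<Sum>v\<in>nbhd U u. (dot d (f u) (f v))\<^sup>2) \<le> 27 * D powr ((real t - 2) / 3)" .
    qed simp
    \<comment> \<open>Since \<open>28 = 1 + 27\<close>, the diagonal term is absorbed, and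
      \<open>28 * d\<close> is the factor \<open>D\<close> that lifts the exponent to
      \<open>(t + 1) / 3\<close>.\<close>
    also have "\<dots> \<le> real d * (28 * D powr ((real t - 2) / 3))"
      using ge_one_powr_ge_zero[OF D, of "(real t - 2) / 3"] step.hyps
      by (intro mult_left_mono) auto
    also have "\<dots> = D * D powr ((real t - 2) / 3)" by (simp add: D_def)
    also have "\<dots> = D powr (real (Suc t) / 3)"
      using D by (simp add: powr_mult_base field_simps)
    finally show ?thesis by (simp add: D_def)
  qed simp
qed

end

section \<open>Transfer to graphs\<close>

lemma card_le_of_orthonormal_rep:
  assumes "pair_graph G" "graph_free (complete_graph t) G" "orthonormal_rep G d f" "3 \<le> t"
  shows "real (card (pverts G)) \<le> (28 * real d) powr (real t / 3)"
proof -
  interpret pair_graph G by fact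
  let ?f = "\<lambda>u i. f u $ i"
  \<comment> \<open>\<open>scalar_prod\<close> takes its index range from its second argument, hence
    the condition on \<open>v\<close>.\<close>
  have dot: "dot d (?f u) (?f v) = scalar_prod (f u) (f v)" if "v \<in> pverts G" for u v
    using assms(3) that by (auto simp: orthonormal_rep_def scalar_prod_def dot_def atLeast0LessThan)
  interpret unit_vectors d ?f "pverts G"
  proof
    fix u assume "u \<in> pverts G"
    then show "dot d (?f u) (?f u) = 1"
      using dot assms(3) by (auto simp: orthonormal_rep_def euclidean_norm_def)
  qed simp
  have "clique_free t (pverts G)"
    unfolding clique_free_def
  proof (intro notI, elim exE conjE)
    fix C assume C: "C \<subseteq> pverts G" "card C = t"
      "\<forall>u\<in>C. \<forall>v\<in>C. u \<noteq> v \<longrightarrow> dot d (?f u) (?f v) \<noteq> 0"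
    have "finite C" using C(1) pair_finite_verts by (rule finite_subset)
    moreover have "(u, v) \<in> parcs G" if "u \<in> C" "v \<in> C" "u \<noteq> v" for u v
      using C that assms(3) dot unfolding orthonormal_rep_def by (metis subset_eq)
    ultimately show False
      using C(1,2) assms(2) unfolding graph_free_complete_graph_iff[OF assms(1)] by blast
  qed
  then show ?thesis using card_le_of_clique_free assms(4) by blast
qed

theorem theorem1p8:
  shows "\<exists>\<delta> :: real. \<delta> > 0 \<and>
    (\<forall>t n :: nat. t \<ge> 3 \<and> n \<ge> 1 \<longrightarrow>
       real (rho n (complete_graph t)) \<ge> \<delta> * real n powr (3 / real t))"
proof (intro exI[of _ "1 / 28"] conjI allI impI)
  fix t n :: nat
  assume tn: "t \<ge> 3 \<and> n \<ge> 1"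
  define r where "r = rho n (complete_graph t)"
  obtain G :: "nat pair_pre_digraph" where G: "pair_graph G" "card (pverts G) = n"
    "graph_free (complete_graph t) G" "msr G = r"
    using rho_attained[of t n] tn by (auto simp: r_def)
  obtain f where "orthonormal_rep G r f" using orthonormal_rep_msr[OF G(1)] G(4) by auto
  then have "real n \<le> (28 * real r) powr (real t / 3)"
    using card_le_of_orthonormal_rep G tn by blast
  \<comment> \<open>The power \<open>3 / t\<close> undoes \<open>t / 3\<close> and leaves
    \<open>28 * r\<close>, whence \<open>\<delta> = 1 / 28\<close> for all \<open>t\<close>.\<close>
  then have "real n powr (3 / real t) \<le> ((28 * real r) powr (real t / 3)) powr (3 / real t)"
    by (intro powr_mono2) auto
  also have "\<dots> = 28 * real r" using tn by (simp add: powr_powr)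
  finally show "real (rho n (complete_graph t)) \<ge> 1 / 28 * real n powr (3 / real t)"
    by (simp add: r_def)
qed simp

end
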